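(* Let $d,n\in\mathbb{N}$. The second-order critical points of the frame potential $\operatorname{FP}\colon\operatorname{S}(d,n)\to\mathbb{R}$, $\operatorname{FP}(Z)=\|Z^*Z\|_F^2$, are precisely the global minimizers of $\operatorname{FP}$ on $\operatorname{S}(d,n)$, namely, the matrices in $\mathbb{C}^{d\times n}$ with orthonormal columns when $n\leq d$, and the $d\times n$ unit norm tight frames when $n\geq d$.
   Context: Here $d,n\geq1$. $\operatorname{S}(d,n)$ is the set of matrices $Z=[z_1\cdots z_n]\in\mathbb{C}^{d\times n}$ all of whose columns have unit (Euclidean) norm, and $\|\cdot\|_F$ is the Frobenius norm. A matrix $Z\in\mathbb{C}^{d\times n}$ is a unit norm tight frame if every column has unit norm and $ZZ^*$ is a multiple of the $d\times d$ identity matrix. Critical points. Let $f,h_1,\ldots,h_m\colon\mathbb{R}^N\to\mathbb{R}$ be twice continuously differentiable and let $S:=\{x\in\mathbb{R}^N:h_1(x)=\cdots=h_m(x)=0\}$. A point $x_0\in S$ is a second-order critical point of $f|_S$ if either the constraint gradients $\{\nabla h_i(x_0)\}_{i=1}^m$ are linearly dependent, or there exist $\lambda_1,\ldots,\lambda_m\in\mathbb{R}$ such that \[ \nabla f(x_0)+\sum_{i=1}^m\lambda_i\nabla h_i(x_0)=0 \quad\text{and}\quad y^\top\Big(\nabla^2 f(x_0)+\sum_{i=1}^m\lambda_i\nabla^2 h_i(x_0)\Big)y\geq0 \] for all $y\in(\operatorname{span}\{\nabla h_i(x_0)\}_{i=1}^m)^\perp$. This is applied by identifying $\mathbb{C}^{d\times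 n}$ with $\mathbb{R}^{2dn}$ via real and imaginary parts of the entries, with $f(Z):=\|Z^*Z\|_F^2$ on all of $\mathbb{C}^{d\times n}$ and with the $m=n$ constraints $h_j(Z):=\|z_j\|^2-1$, where $z_j$ is the $j$th column of $Z$, so that $S=\operatorname{S}(d,n)$. *)

theory Defs
  imports "HOL-Analysis.Analysis"
begin

section \<open>Second-order critical points\<close>

text \<open>
  The ambient space is an arbitrary Euclidean space. The gradient and the Hessian (the latter as
  a linear map, the derivative of the gradient) are meaningful at points where the function is
  twice differentiable, as in the lemmas below; elsewhere their values are unspecified.
\<close>

definition grad :: "('a::euclidean_space \<Rightarrow> real) \<Rightarrow> 'a \<Rightarrow> 'a"
  where "grad f x = (THE g. GDERIV f x :> g)"

definition hess :: "('a::euclidean_space \<Rightarrow> real) \<Rightarrow> 'a \<Rightarrow> 'a \<Rightarrow> 'a"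
  where "hess f x = frechet_derivative (grad f) (at x)"

lemma grad_eqI: "GDERIV f x :> g \<Longrightarrow> grad f x = g"
  unfolding grad_def
proof (rule the_equality)
  fix g' assume "GDERIV f x :> g" "GDERIV f x :> g'"
  then have "(\<lambda>h. h \<bullet> g') = (\<lambda>h. h \<bullet> g)"
    unfolding gderiv_def by (blast intro: has_derivative_unique)
  then show "g' = g"
    by (metis vector_eq_ldot)
qed

lemma hess_eqI:
  assumes "\<And>z. GDERIV f z :> g z" and "(g has_derivative H) (at x)"
  shows "hess f x = H"
proof -
  have "grad f = g"
    using assms(1) by (auto intro: grad_eqI)
  then show ?thesis
    using assms(2) by (simp add: hess_def frechet_derivative_at[symmetric])
qed

text \<open>
  Linear dependence of an indexed family: unlike for dependence of the range, repeated
  vectors make a family dependent.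
\<close>

definition family_dependent :: "('m::finite \<Rightarrow> 'a::real_vector) \<Rightarrow> bool"
  where "family_dependent v \<longleftrightarrow>
    (\<exists>c :: 'm \<Rightarrow> real. (\<exists>i. c i \<noteq> 0) \<and> (\<Sum>i\<in>UNIV. c i *\<^sub>R v i) = 0)"

definition second_order_critical ::
    "('a::euclidean_space \<Rightarrow> real) \<Rightarrow> ('m::finite \<Rightarrow> 'a \<Rightarrow> real) \<Rightarrow> 'a \<Rightarrow> bool"
  where "second_order_critical f h x \<longleftrightarrow>
    (\<forall>i. h i x = 0) \<and>
    (family_dependent (\<lambda>i. grad (h i) x) \<or>
     (\<exists>\<mu> :: 'm \<Rightarrow> real.
        grad f x + (\<Sum>i\<in>UNIV. \<mu> i *\<^sub>R grad (h i) x) = 0 \<and>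
        (\<forall>y \<in> (span (range (\<lambda>i. grad (h i) x)))\<^sup>\<bottom>.
           y \<bullet> (hess f x y + (\<Sum>i\<in>UNIV. \<mu> i *\<^sub>R hess (h i) x y)) \<ge> 0)))"


section \<open>The frame potential\<close>

text \<open>
  A \<open>d \<times> n\<close> complex matrix has type \<^typ>\<open>complex^'n^'d\<close>. The library's norm on this
  type is the Frobenius norm, and its real inner product is the one obtained by identifying
  the matrices with \<open>\<real>\<^sup>2\<^sup>d\<^sup>n\<close> through the real and imaginary parts of the entries.
\<close>

lemma norm_eq_Frobenius:
  fixes A :: "complex^'n^'m"
  shows "(norm A)\<^sup>2 = (\<Sum>i\<in>UNIV. \<Sum>j\<in>UNIV. (cmod (A $ i $ j))\<^sup>2)"
  by (simp add: norm_vec_def L2_set_def sum_nonneg)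

lemma inner_eq_Re_Im:
  fixes A B :: "complex^'n^'m"
  shows "A \<bullet> B = (\<Sum>i\<in>UNIV. \<Sum>j\<in>UNIV.
           Re (A $ i $ j) * Re (B $ i $ j) + Im (A $ i $ j) * Im (B $ i $ j))"
  by (simp add: inner_vec_def inner_complex_def)

definition ctranspose :: "complex^'n^'m \<Rightarrow> complex^'m^'n"
  where "ctranspose A = (\<chi> i j. cnj (A $ j $ i))"

definition unit_norm_columns :: "(complex^'n^'d) set"
  where "unit_norm_columns = {Z. \<forall>j. norm (column j Z) = 1}"

definition column_constraint :: "'n::finite \<Rightarrow> complex^'n^'d \<Rightarrow> real"
  where "column_constraint j Z = (norm (column j Z))\<^sup>2 - 1"

lemma unit_norm_columns_eq_zero_set:
  "(unit_norm_columns :: (complex^'n^'d) set) = {Z. \<forall>j. column_constraint j Z = 0}"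
proof -
  have "norm v = 1 \<longleftrightarrow> (norm v)\<^sup>2 - 1 = 0" for v :: "complex^'d"
    using norm_ge_zero[of v] by (smt (verit) power2_eq_1_iff)
  then show ?thesis
    by (simp add: unit_norm_columns_def column_constraint_def)
qed

definition frame_potential :: "complex^'n^'d \<Rightarrow> real"
  where "frame_potential Z = (norm (ctranspose Z ** Z))\<^sup>2"

definition orthonormal_columns :: "complex^'n^'d \<Rightarrow> bool"
  where "orthonormal_columns Z \<longleftrightarrow>
    (\<forall>j k. (\<Sum>i\<in>UNIV. cnj (column j Z $ i) * column k Z $ i) = (if j = k then 1 else 0))"

definition unit_norm_tight_frame :: "complex^'n^'d \<Rightarrow> bool"
  where "unit_norm_tight_frame Z \<longleftrightarrow>
    (\<forall>j. norm (column j Z) = 1) \<and> (\<exists>c. Z ** ctranspose Z = mat c)"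

end

theory Submission
  imports Defs
begin

text \<open>
  Let \<open>Z\<^sup>*\<close> be the conjugate transpose, \<open>G = Z\<^sup>* Z\<close> the Gram matrix and \<open>S = Z Z\<^sup>*\<close> the frame
  operator of a \<open>d \<times> n\<close> matrix \<open>Z\<close> with unit columns \<open>z\<^sub>j\<close>. Since the trace of both is \<open>n\<close>,
  expanding squares gives \<open>FP(Z) - n = \<parallel>G - I\<parallel>\<^sup>2\<close> and \<open>FP(Z) - n\<^sup>2/d = \<parallel>S - (n/d) I\<parallel>\<^sup>2\<close>.
  So \<open>n\<close> and \<open>n\<^sup>2/d\<close> are lower bounds, attained exactly by orthonormal columns and by unit norm
  tight frames respectively. Part of the standard basis (\<open>n \<le> d\<close>) and some rows of the discrete
  Fourier matrix (\<open>n \<ge> d\<close>) show that the larger of the two bounds is attained, which identifies the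
  global minimizers (\<open>is_arg_min_iff_orthonormal\<close>, \<open>is_arg_min_iff_tight\<close>).

  For criticality, the gradients of the constraints live in different columns, hence are
  independent, and criticality means (\<open>second_order_critical_frame_potential_iff\<close>) that
  \<open>S z\<^sub>j = \<mu>\<^sub>j z\<^sub>j\<close> for real multipliers \<open>\<mu>\<^sub>j\<close>, together with an inequality for tangent
  directions \<open>Y\<close>. If \<open>G = I\<close> or \<open>S\<close> is scalar, all \<open>\<mu>\<^sub>j\<close> agree and the Hessian of the
  Lagrangian, as a quadratic form in \<open>Y\<close>, is twice a squared norm.

  Conversely, let \<open>Z\<close> be critical. Comparing \<open>G\<^sup>2 = G diag(\<mu>)\<close> with its adjoint shows that columns
  with different multipliers are orthogonal, and its diagonal says \<open>\<mu>\<^sub>j = \<Sum>\<^sub>l |G\<^sub>l\<^sub>j|\<^sup>2 \<ge> 1\<close>. If the largest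
  multiplier is \<open>1\<close>, the off-diagonal entries of \<open>G\<close> vanish. If the largest multiplier \<open>\<mu>\<^sub>k\<close> exceeds
  \<open>1\<close>, then the equation \<open>S z\<^sub>k = \<mu>\<^sub>k z\<^sub>k\<close> is a nontrivial linear dependence among the columns with
  this multiplier. Adding to these columns suitable multiples of one vector \<open>v\<close> that is orthogonal
  to all of them leaves \<open>S\<close> unchanged to first order, so the second-order condition forces
  \<open>\<langle>S v, v\<rangle> \<ge> \<mu>\<^sub>k \<parallel>v\<parallel>\<^sup>2\<close> (\<open>rank_one_test\<close>). Taking \<open>v = z\<^sub>j\<close> with \<open>\<mu>\<^sub>j < \<mu>\<^sub>k\<close> shows that there is no such
  \<open>j\<close>; taking for \<open>v\<close> the columns of \<open>S - \<mu>\<^sub>k I\<close>, which \<open>Z\<^sup>*\<close> annihilates, gives \<open>S = \<mu>\<^sub>k I\<close>. So \<open>Z\<close> is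
  orthonormal or tight, and comparing the two lower bounds shows that it is a minimizer.
\<close>

section \<open>The adjoint of matrix multiplication\<close>

lemma ctranspose_nth [simp]: "ctranspose A $ i $ j = cnj (A $ j $ i)"
  by (simp add: ctranspose_def)

lemma matrix_mult_nth: "(A ** B) $ i $ j = (\<Sum>k\<in>UNIV. A $ i $ k * B $ k $ j)"
  by (simp add: matrix_matrix_mult_def)

lemma ctranspose_ctranspose [simp]: "ctranspose (ctranspose A) = A"
  by (simp add: vec_eq_iff)

lemma ctranspose_mult: "ctranspose (A ** B) = ctranspose B ** ctranspose A"
  by (simp add: vec_eq_iff matrix_mult_nth mult.commute)

lemma matrix_inner_eq_Re_sum:
  fixes A B :: "complex^'n^'m"
  shows "A \<bullet> B = Re (\<Sum>i\<in>UNIV. \<Sum>j\<in>UNIV. cnj (A $ i $ j) * B $ i $ j)"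
  by (simp add: inner_eq_Re_Im)

lemma inner_ctranspose [simp]: "ctranspose A \<bullet> ctranspose B = A \<bullet> B"
  unfolding inner_eq_Re_Im by (subst sum.swap) simp

text \<open>
  The matrix inner product is the real part of the trace of \<open>A\<^sup>* B\<close>, so a factor moves to the
  other side as its conjugate transpose. This replaces all entrywise work with the Hessian.
\<close>

lemma inner_mult_left:
  "(A ** B) \<bullet> C = B \<bullet> (ctranspose A ** C)"
proof -
  have "(\<Sum>i\<in>UNIV. \<Sum>j\<in>UNIV. cnj ((A ** B) $ i $ j) * C $ i $ j)
      = (\<Sum>i\<in>UNIV. \<Sum>j\<in>UNIV. \<Sum>k\<in>UNIV. cnj (A $ i $ k) * cnj (B $ k $ j) * C $ i $ j)"
    by (simp add: matrix_mult_nth sum_distrib_right)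
  also have "\<dots> = (\<Sum>j\<in>UNIV. \<Sum>i\<in>UNIV. \<Sum>k\<in>UNIV. cnj (A $ i $ k) * cnj (B $ k $ j) * C $ i $ j)"
    by (rule sum.swap)
  also have "\<dots> = (\<Sum>j\<in>UNIV. \<Sum>k\<in>UNIV. \<Sum>i\<in>UNIV. cnj (A $ i $ k) * cnj (B $ k $ j) * C $ i $ j)"
    by (intro sum.cong refl sum.swap)
  also have "\<dots> = (\<Sum>k\<in>UNIV. \<Sum>j\<in>UNIV. \<Sum>i\<in>UNIV. cnj (A $ i $ k) * cnj (B $ k $ j) * C $ i $ j)"
    by (rule sum.swap)
  also have "\<dots> = (\<Sum>k\<in>UNIV. \<Sum>j\<in>UNIV. cnj (B $ k $ j) * (ctranspose A ** C) $ k $ j)"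
    by (simp add: matrix_mult_nth sum_distrib_left mult_ac)
  finally show ?thesis
    by (simp add: matrix_inner_eq_Re_sum)
qed

lemma inner_mult_right:
  "(A ** B) \<bullet> C = A \<bullet> (C ** ctranspose B)"
proof -
  have "(A ** B) \<bullet> C = (ctranspose B ** ctranspose A) \<bullet> ctranspose C"
    by (metis ctranspose_mult inner_ctranspose)
  also have "\<dots> = ctranspose A \<bullet> ctranspose (C ** ctranspose B)"
    by (simp add: inner_mult_left ctranspose_mult)
  finally show ?thesis by simp
qed

text \<open>
  Moving one factor across each side of the inner product turns the Gram matrix into the frame
  operator, whose distance from scalar matrices gives the bound by \<open>n\<^sup>2/d\<close>.
\<close>

lemma frame_potential_eq: "frame_potential Z = (norm (Z ** ctranspose Z))\<^sup>2"
  unfolding frame_potential_def power2_norm_eq_inner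
  by (metis ctranspose_ctranspose inner_mult_left inner_mult_right matrix_mul_assoc)

section \<open>Gradients and Hessians\<close>

lemma bounded_bilinear_matrix_mult:
  "bounded_bilinear (\<lambda>(A::complex^'n^'m) (B::complex^'k^'n). A ** B)"
  unfolding bilinear_conv_bounded_bilinear[symmetric] bilinear_def
  by (auto intro!: linearI simp: vec_eq_iff matrix_mult_nth sum.distrib algebra_simps
      scaleR_conv_of_real[where 'a=complex] sum_distrib_left)

lemma bounded_linear_ctranspose: "bounded_linear ctranspose"
  unfolding linear_conv_bounded_linear[symmetric]
  by (auto intro!: linearI simp: vec_eq_iff)

lemma gderiv_frame_potential:
  "GDERIV frame_potential Z :> 4 *\<^sub>R (Z ** ctranspose Z ** Z)"
proof -
  note ct = bounded_linear.has_derivative[OF bounded_linear_ctranspose]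
  note mm = bounded_bilinear.FDERIV[OF bounded_bilinear_matrix_mult]
  have "(frame_potential has_derivative (\<lambda>Y.
      (ctranspose Z ** Z) \<bullet> (ctranspose Z ** Y + ctranspose Y ** Z) +
      (ctranspose Z ** Y + ctranspose Y ** Z) \<bullet> (ctranspose Z ** Z))) (at Z)"
    unfolding frame_potential_def power2_norm_eq_inner
    by (rule has_derivative_inner[OF mm[OF ct[OF has_derivative_ident] has_derivative_ident]
            mm[OF ct[OF has_derivative_ident] has_derivative_ident]])
  moreover have "(ctranspose Z ** Z) \<bullet> (ctranspose Z ** Y + ctranspose Y ** Z) +
      (ctranspose Z ** Y + ctranspose Y ** Z) \<bullet> (ctranspose Z ** Z)
      = Y \<bullet> (4 *\<^sub>R (Z ** ctranspose Z ** Z))" for Y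
  proof -
    have 1: "(ctranspose Z ** Y) \<bullet> (ctranspose Z ** Z) = Y \<bullet> (Z ** ctranspose Z ** Z)"
      by (simp add: inner_mult_left matrix_mul_assoc)
    have "(ctranspose Y ** Z) \<bullet> (ctranspose Z ** Z)
        = ctranspose (ctranspose Z ** Y) \<bullet> ctranspose (ctranspose Z ** Z)"
      by (simp add: ctranspose_mult)
    then have 2: "(ctranspose Y ** Z) \<bullet> (ctranspose Z ** Z) = Y \<bullet> (Z ** ctranspose Z ** Z)"
      unfolding inner_ctranspose using 1 by simp
    show ?thesis
      using 1 2 by (simp add: inner_add_left inner_commute[of "ctranspose Z ** Z"])
  qed
  ultimately show ?thesis
    by (simp add: gderiv_def)
qed

lemma hess_frame_potential:
  "hess frame_potential Z Y =
    4 *\<^sub>R (Z ** ctranspose Z ** Y + (Z ** ctranspose Y + Y ** ctranspose Z) ** Z)"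
proof -
  note ct = bounded_linear.has_derivative[OF bounded_linear_ctranspose]
  note mm = bounded_bilinear.FDERIV[OF bounded_bilinear_matrix_mult]
  have "((\<lambda>Z. 4 *\<^sub>R (Z ** ctranspose Z ** Z)) has_derivative (\<lambda>Y.
      4 *\<^sub>R (Z ** ctranspose Z ** Y + (Z ** ctranspose Y + Y ** ctranspose Z) ** Z))) (at Z)"
    by (intro has_derivative_scaleR_right mm ct has_derivative_ident)
  from hess_eqI[OF gderiv_frame_potential this] show ?thesis by simp
qed

definition keep_column :: "'n \<Rightarrow> complex^'n^'d \<Rightarrow> complex^'n^'d"
  where "keep_column j Z = (\<chi> i k. if k = j then Z $ i $ k else 0)"

lemma keep_column_nth: "keep_column j Z $ i $ k = (if k = j then Z $ i $ k else 0)"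
  by (simp add: keep_column_def)

lemma bounded_linear_keep_column: "bounded_linear (keep_column j)"
  unfolding linear_conv_bounded_linear[symmetric]
  by (auto intro!: linearI simp: vec_eq_iff keep_column_nth)

lemma inner_keep_column: "keep_column j Z \<bullet> Y = column j Z \<bullet> column j Y"
  by (simp add: inner_vec_def keep_column_nth column_def if_distrib[of "\<lambda>x. x \<bullet> _"] cong: if_cong)

lemma gderiv_column_constraint:
  "GDERIV (column_constraint j) Z :> 2 *\<^sub>R keep_column j Z"
proof -
  have eq: "column_constraint j = (\<lambda>Z. keep_column j Z \<bullet> Z - 1)"
    by (auto simp: column_constraint_def power2_norm_eq_inner inner_keep_column)
  have "(column_constraint j has_derivative
      (\<lambda>Y. keep_column j Z \<bullet> Y + keep_column j Y \<bullet> Z - 0)) (at Z)"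
    unfolding eq
    by (intro has_derivative_diff has_derivative_inner has_derivative_const has_derivative_ident
        bounded_linear.has_derivative[OF bounded_linear_keep_column])
  moreover have "keep_column j Z \<bullet> Y + keep_column j Y \<bullet> Z - 0 = Y \<bullet> (2 *\<^sub>R keep_column j Z)" for Y
    by (simp add: inner_commute[of Y] inner_keep_column inner_commute[of "column j Y"])
  ultimately show ?thesis
    by (simp add: gderiv_def)
qed

lemma hess_column_constraint: "hess (column_constraint j) Z Y = 2 *\<^sub>R keep_column j Y"
proof -
  have "((\<lambda>Z. 2 *\<^sub>R keep_column j Z) has_derivative (\<lambda>Y. 2 *\<^sub>R keep_column j Y)) (at Z)"
    by (intro has_derivative_scaleR_right bounded_linear.has_derivative[OF bounded_linear_keep_column]
         has_derivative_ident)
  from hess_eqI[OF gderiv_column_constraint this] show ?thesis by simp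
qed

lemma sum_scaled_keep_columns_nth:
  "(\<Sum>j\<in>UNIV. c j *\<^sub>R keep_column j Z) $ i $ k = c k *\<^sub>R (Z $ i $ k)"
proof -
  have "(\<Sum>j\<in>UNIV. c j *\<^sub>R keep_column j Z) $ i $ k
      = (\<Sum>j\<in>UNIV. if j = k then c k *\<^sub>R (Z $ i $ k) else 0)"
    unfolding sum_component by (intro sum.cong refl) (auto simp: keep_column_nth)
  then show ?thesis by simp
qed

text \<open>
  The gradients are supported in pairwise different columns and are nonzero, so the degenerate
  alternative in the notion of a critical point never occurs here.
\<close>

lemma column_constraint_gradients_independent:
  fixes Z :: "complex^'n^'d"
  assumes unit: "\<And>j. norm (column j Z) = 1"
  shows "\<not> family_dependent (\<lambda>j. grad (column_constraint j) Z)"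
proof
  assume "family_dependent (\<lambda>j. grad (column_constraint j) Z)"
  then obtain c :: "'n \<Rightarrow> real" and k where k: "c k \<noteq> 0"
    and "(\<Sum>j\<in>UNIV. c j *\<^sub>R grad (column_constraint j) Z) = 0"
    unfolding family_dependent_def by blast
  then have "(\<Sum>j\<in>UNIV. (2 * c j) *\<^sub>R keep_column j Z) = 0"
    by (simp add: grad_eqI[OF gderiv_column_constraint] mult.commute)
  then have "(2 * c k) *\<^sub>R (Z $ i $ k) = 0" for i
    using sum_scaled_keep_columns_nth[of "\<lambda>j. 2 * c j" Z i k] by simp
  then have "column k Z = 0"
    using k by (simp add: vec_eq_iff column_def)
  then show False using unit[of k] by simp
qed

lemma mem_orthogonal_comp_span_range:
  "y \<in> (span (range g))\<^sup>\<bottom> \<longleftrightarrow> (\<forall>i. g i \<bullet> y = 0)"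
proof
  assume "y \<in> (span (range g))\<^sup>\<bottom>"
  then show "\<forall>i. g i \<bullet> y = 0"
    unfolding orthogonal_comp_def orthogonal_def by (blast intro: span_base)
next
  assume "\<forall>i. g i \<bullet> y = 0"
  then have "\<And>z. z \<in> range g \<Longrightarrow> orthogonal y z"
    by (auto simp: orthogonal_def inner_commute)
  then have "x \<in> span (range g) \<Longrightarrow> orthogonal y x" for x
    using orthogonal_to_span by blast
  then show "y \<in> (span (range g))\<^sup>\<bottom>"
    unfolding orthogonal_comp_def by (simp add: orthogonal_commute)
qed

text \<open>
  With the normalization \<open>-2 \<mu>\<^sub>j\<close> of the Lagrange multipliers, stationarity says that \<open>z\<^sub>j\<close> is
  an eigenvector of the frame operator with eigenvalue \<open>\<mu>\<^sub>j\<close>, and a common factor \<open>4\<close> drops out of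
  the second-order condition.
\<close>

lemma second_order_critical_frame_potential_iff:
  fixes Z :: "complex^'n^'d"
  shows "second_order_critical frame_potential column_constraint Z \<longleftrightarrow>
    (\<forall>j. norm (column j Z) = 1) \<and>
    (\<exists>\<mu>::'n \<Rightarrow> real.
      (\<forall>i j. (Z ** ctranspose Z ** Z) $ i $ j = \<mu> j *\<^sub>R (Z $ i $ j)) \<and>
      (\<forall>Y. (\<forall>j. column j Z \<bullet> column j Y = 0) \<longrightarrow>
        (\<Sum>j\<in>UNIV. \<mu> j * (norm (column j Y))\<^sup>2)
          \<le> Y \<bullet> (Z ** ctranspose Z ** Y + (Z ** ctranspose Y + Y ** ctranspose Z) ** Z)))"
    (is "_ \<longleftrightarrow> ?U \<and> (\<exists>\<mu>. ?E \<mu> \<and> (\<forall>Y. ?T Y \<longrightarrow> ?q \<mu> Y \<le> Y \<bullet> ?H Y))")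
proof -
  have U: "(\<forall>j. column_constraint j Z = 0) \<longleftrightarrow> ?U"
    using unit_norm_columns_eq_zero_set by (auto simp: unit_norm_columns_def)
  have g: "grad frame_potential Z + (\<Sum>j\<in>UNIV. \<nu> j *\<^sub>R grad (column_constraint j) Z) = 0
      \<longleftrightarrow> ?E (\<lambda>j. - \<nu> j / 2)" for \<nu> :: "'n \<Rightarrow> real"
  proof -
    have entry: "(grad frame_potential Z + (\<Sum>j\<in>UNIV. \<nu> j *\<^sub>R grad (column_constraint j) Z)) $ i $ k
      = 4 *\<^sub>R ((Z ** ctranspose Z ** Z) $ i $ k - (- \<nu> k / 2) *\<^sub>R (Z $ i $ k))" for i k
      using sum_scaled_keep_columns_nth[of "\<lambda>j. \<nu> j * 2" Z i k]
      by (simp add: grad_eqI[OF gderiv_column_constraint] grad_eqI[OF gderiv_frame_potential]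
          algebra_simps)
    show ?thesis
      unfolding vec_eq_iff zero_index by (simp only: entry scaleR_eq_0_iff right_minus_eq) simp
  qed
  have T: "Y \<in> (span (range (\<lambda>j. grad (column_constraint j) Z)))\<^sup>\<bottom> \<longleftrightarrow> ?T Y" for Y
    by (simp add: mem_orthogonal_comp_span_range grad_eqI[OF gderiv_column_constraint]
        inner_keep_column)
  have H: "Y \<bullet> (hess frame_potential Z Y + (\<Sum>j\<in>UNIV. \<nu> j *\<^sub>R hess (column_constraint j) Z Y))
     \<ge> 0 \<longleftrightarrow> ?q (\<lambda>j. - \<nu> j / 2) Y \<le> Y \<bullet> ?H Y" for \<nu> :: "'n \<Rightarrow> real" and Y
  proof -
    have "Y \<bullet> keep_column j Y = (norm (column j Y))\<^sup>2" for j
      by (simp add: inner_commute[of Y] inner_keep_column power2_norm_eq_inner)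
    then have "Y \<bullet> (\<Sum>j\<in>UNIV. \<nu> j *\<^sub>R hess (column_constraint j) Z Y)
        = (\<Sum>j\<in>UNIV. - 4 * (- \<nu> j / 2 * (norm (column j Y))\<^sup>2))"
      unfolding inner_sum_right hess_column_constraint by (intro sum.cong refl) simp
    then have multipliers: "Y \<bullet> (\<Sum>j\<in>UNIV. \<nu> j *\<^sub>R hess (column_constraint j) Z Y)
        = - 4 * ?q (\<lambda>j. - \<nu> j / 2) Y"
      by (simp only: sum_distrib_left)
    have "Y \<bullet> hess frame_potential Z Y = 4 * (Y \<bullet> ?H Y)"
      by (simp only: hess_frame_potential inner_scaleR_right)
    with multipliers show ?thesis
      unfolding inner_add_right[of Y "hess frame_potential Z Y"] by linarith
  qed
  have "second_order_critical frame_potential column_constraint Z \<longleftrightarrow> ?U \<and>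
    (\<exists>\<nu>. ?E (\<lambda>j. - \<nu> j / 2) \<and> (\<forall>Y. ?T Y \<longrightarrow> ?q (\<lambda>j. - \<nu> j / 2) Y \<le> Y \<bullet> ?H Y))"
    unfolding second_order_critical_def U g Ball_def T H
    by (rule conj_cong[OF refl])
      (simp only: column_constraint_gradients_independent simp_thms)
  also have "\<dots> \<longleftrightarrow> ?U \<and> (\<exists>\<mu>. ?E \<mu> \<and> (\<forall>Y. ?T Y \<longrightarrow> ?q \<mu> Y \<le> Y \<bullet> ?H Y))"
  proof -
    have "(\<exists>\<nu>. P (\<lambda>j. - \<nu> j / 2)) \<longleftrightarrow> (\<exists>\<mu>. P \<mu>)" for P :: "('n \<Rightarrow> real) \<Rightarrow> bool"
    proof
      assume "\<exists>\<mu>. P \<mu>"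
      then obtain \<mu> where "P \<mu>" ..
      then show "\<exists>\<nu>. P (\<lambda>j. - \<nu> j / 2)"
        by (intro exI[of _ "\<lambda>j. - 2 * \<mu> j"]) simp
    qed auto
    from this[of "\<lambda>\<mu>. ?E \<mu> \<and> (\<forall>Y. ?T Y \<longrightarrow> ?q \<mu> Y \<le> Y \<bullet> ?H Y)"] show ?thesis
      by (rule conj_cong[OF refl])
  qed
  finally show ?thesis .
qed


section \<open>The two lower bounds\<close>

lemma column_nth: "column j Z $ i = Z $ i $ j"
  by (simp add: column_def)

lemma norm_vec_power2: "(norm v)\<^sup>2 = (\<Sum>i\<in>UNIV. (norm (v $ i))\<^sup>2)"
  by (simp add: norm_vec_def L2_set_def sum_nonneg)

lemma gram_diagonal:
  "(ctranspose Z ** Z) $ j $ j = of_real ((norm (column j Z))\<^sup>2)"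
  unfolding norm_vec_power2 of_real_sum complex_norm_square column_nth
  by (simp add: matrix_mult_nth mult.commute)

lemma gram_eq_inner:
  "column j Y \<bullet> column k Z = Re ((ctranspose Y ** Z) $ j $ k)"
  by (simp add: inner_vec_def inner_complex_def matrix_mult_nth column_nth)

lemma norm_power2_eq_sum_columns:
  fixes Z :: "complex^'n^'d"
  shows "(norm Z)\<^sup>2 = (\<Sum>j\<in>UNIV. (norm (column j Z))\<^sup>2)"
  unfolding norm_eq_Frobenius norm_vec_power2[of "column _ _"] column_nth by (rule sum.swap)

lemma norm_power2_of_unit_columns:
  fixes Z :: "complex^'n^'d"
  assumes "\<And>j. norm (column j Z) = 1"
  shows "(norm Z)\<^sup>2 = CARD('n)"
  by (simp add: norm_power2_eq_sum_columns assms)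

lemma mat_of_real_mult: "mat (of_real r) ** A = r *\<^sub>R (A :: complex^'n^'d)"
  by (simp add: vec_eq_iff matrix_mult_nth mat_def if_distrib[of "\<lambda>x. x * _"]
      scaleR_conv_of_real[where 'a=complex] cong: if_cong)

lemma mult_mat_of_real: "A ** mat (of_real r) = r *\<^sub>R (A :: complex^'n^'d)"
  by (simp add: vec_eq_iff matrix_mult_nth mat_def if_distrib[of "\<lambda>x. _ * x"]
      scaleR_conv_of_real[where 'a=complex] mult.commute cong: if_cong)

lemma ctranspose_mat_of_real: "ctranspose (mat (of_real r)) = mat (of_real r)"
  by (auto simp: vec_eq_iff mat_def)

lemma norm_mat_of_real: "(norm (mat (of_real r) :: complex^'n^'n))\<^sup>2 = r\<^sup>2 * CARD('n)"
proof -
  have "(cmod ((mat (of_real r) :: complex^'n^'n) $ i $ j))\<^sup>2 = (if i = j then r\<^sup>2 else 0)" for i j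
    by (simp add: mat_def)
  then show ?thesis
    by (simp add: norm_eq_Frobenius)
qed

lemma norm_diff_power2: "(norm (x - y))\<^sup>2 = (norm x)\<^sup>2 - 2 * (x \<bullet> y) + (norm y)\<^sup>2"
  for x y :: "'a::real_inner"
  by (simp add: power2_norm_eq_inner inner_diff_left inner_diff_right inner_commute)

text \<open>
  The inner product of \<open>Z\<^sup>* Z\<close> with \<open>r I\<close> is \<open>r\<close> times the trace, that is
  \<open>r \<parallel>Z\<parallel>\<^sup>2\<close>; the same holds for \<open>Z Z\<^sup>*\<close> below.
\<close>

lemma norm_gram_diff_scalar:
  fixes Z :: "complex^'n^'d"
  shows "(norm (ctranspose Z ** Z - mat (of_real r)))\<^sup>2
    = frame_potential Z - 2 * r * (norm Z)\<^sup>2 + r\<^sup>2 * CARD('n)"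
  unfolding norm_diff_power2 norm_mat_of_real inner_mult_left
  by (simp add: frame_potential_def mult_mat_of_real power2_norm_eq_inner)

lemma norm_frame_operator_diff_scalar:
  fixes Z :: "complex^'n^'d"
  shows "(norm (Z ** ctranspose Z - mat (of_real r)))\<^sup>2
    = frame_potential Z - 2 * r * (norm Z)\<^sup>2 + r\<^sup>2 * CARD('d)"
  unfolding norm_diff_power2 norm_mat_of_real inner_mult_right
  by (simp add: frame_potential_eq mat_of_real_mult power2_norm_eq_inner)

lemma orthonormal_columns_iff_gram: "orthonormal_columns Z \<longleftrightarrow> ctranspose Z ** Z = mat 1"
  by (simp add: orthonormal_columns_def vec_eq_iff matrix_mult_nth column_nth mat_def)

lemma unit_columns_if_orthonormal:
  assumes "orthonormal_columns Z"
  shows "norm (column j Z) = 1"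
proof -
  have "complex_of_real ((norm (column j Z))\<^sup>2) = 1"
    using assms gram_diagonal[of Z j] by (simp add: orthonormal_columns_iff_gram mat_def)
  then have "(norm (column j Z))\<^sup>2 = 1"
    using of_real_eq_1_iff by blast
  then show ?thesis
    using norm_ge_zero[of "column j Z"] by (smt (verit) power2_eq_1_iff)
qed

lemma frame_potential_minus_card:
  fixes Z :: "complex^'n^'d"
  assumes "\<And>j. norm (column j Z) = 1"
  shows "frame_potential Z - CARD('n) = (norm (ctranspose Z ** Z - mat 1))\<^sup>2"
  using norm_gram_diff_scalar[of Z 1] norm_power2_of_unit_columns[OF assms] by simp

text \<open>
  The value \<open>r = n/d\<close> minimizes the quadratic \<open>FP(Z) - 2 r n + r\<^sup>2 d\<close> in \<open>r\<close>. The resulting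
  lower bound for the frame potential is known as the Welch bound.
\<close>

lemma frame_potential_minus_Welch:
  fixes Z :: "complex^'n^'d"
  assumes "\<And>j. norm (column j Z) = 1"
  shows "frame_potential Z - (real CARD('n))\<^sup>2 / CARD('d)
    = (norm (Z ** ctranspose Z - mat (of_real (CARD('n) / CARD('d)))))\<^sup>2"
  unfolding norm_frame_operator_diff_scalar norm_power2_of_unit_columns[OF assms]
  by (simp add: field_simps power2_eq_square)

lemma orthonormal_columns_iff_frame_potential:
  fixes Z :: "complex^'n^'d"
  assumes "\<And>j. norm (column j Z) = 1"
  shows "orthonormal_columns Z \<longleftrightarrow> frame_potential Z = CARD('n)"
  using frame_potential_minus_card[OF assms] by (auto simp: orthonormal_columns_iff_gram)

text \<open>
  Comparing traces determines the constant; in particular it is real.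
\<close>

lemma frame_constant:
  fixes Z :: "complex^'n^'d"
  assumes unit: "\<And>j. norm (column j Z) = 1" and tight: "Z ** ctranspose Z = mat c"
  shows "c = of_real (CARD('n) / CARD('d))"
proof -
  have "of_nat CARD('d) * c = (\<Sum>i\<in>UNIV. (Z ** ctranspose Z) $ i $ i)"
    by (simp add: tight mat_def)
  also have "\<dots> = of_real ((norm Z)\<^sup>2)"
    unfolding norm_eq_Frobenius of_real_sum complex_norm_square by (simp add: matrix_mult_nth)
  also have "\<dots> = of_nat CARD('n)"
    by (simp add: norm_power2_of_unit_columns[OF unit])
  finally show ?thesis
    by (simp add: field_simps)
qed

lemma unit_norm_tight_frame_iff_frame_potential:
  fixes Z :: "complex^'n^'d"
  assumes "\<And>j. norm (column j Z) = 1"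
  shows "unit_norm_tight_frame Z \<longleftrightarrow> frame_potential Z = (real CARD('n))\<^sup>2 / CARD('d)"
proof -
  have "unit_norm_tight_frame Z
      \<longleftrightarrow> Z ** ctranspose Z = mat (of_real (CARD('n) / CARD('d)))"
    using frame_constant[OF assms] assms unfolding unit_norm_tight_frame_def by blast
  then show ?thesis
    using frame_potential_minus_Welch[OF assms] by auto
qed

section \<open>Orthonormal columns and tight frames are critical\<close>

text \<open>
  What remains of the Hessian of the Lagrangian has this form at both kinds of minimizers, with
  \<open>A = Z\<^sup>* Y\<close> for orthonormal columns and \<open>A = Y Z\<^sup>*\<close> for tight frames.
\<close>

lemma inner_plus_ctranspose_nonneg: "0 \<le> A \<bullet> (ctranspose A + A)"
proof -
  have "A \<bullet> (ctranspose A + A) = (norm (ctranspose A + A))\<^sup>2 / 2"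
    by (simp add: power2_norm_eq_inner inner_add_left inner_add_right inner_commute[of "ctranspose A" A])
  then show ?thesis
    using zero_le_power2[of "norm (ctranspose A + A)"] by linarith
qed

text \<open>
  All multipliers are \<open>1\<close>, and the term \<open>Y Z\<^sup>* Z = Y\<close> of the Hessian cancels them.
\<close>

lemma critical_if_orthonormal:
  fixes Z :: "complex^'n^'d"
  assumes "orthonormal_columns Z"
  shows "second_order_critical frame_potential column_constraint Z"
proof -
  have gram: "ctranspose Z ** Z = mat 1"
    using assms by (simp add: orthonormal_columns_iff_gram)
  have "(norm Y)\<^sup>2 \<le> Y \<bullet> (Z ** ctranspose Z ** Y + (Z ** ctranspose Y + Y ** ctranspose Z) ** Z)" for Y
  proof -
    have "Z ** ctranspose Z ** Y + (Z ** ctranspose Y + Y ** ctranspose Z) ** Z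
        = Z ** (ctranspose (ctranspose Z ** Y) + ctranspose Z ** Y) + Y"
      by (simp add: bounded_bilinear.add_left[OF bounded_bilinear_matrix_mult]
          bounded_bilinear.add_right[OF bounded_bilinear_matrix_mult] ctranspose_mult matrix_mul_assoc[symmetric] gram)
    moreover have "Y \<bullet> (Z ** (ctranspose (ctranspose Z ** Y) + ctranspose Z ** Y))
        = (ctranspose Z ** Y) \<bullet> (ctranspose (ctranspose Z ** Y) + ctranspose Z ** Y)"
      by (simp add: inner_mult_left)
    ultimately show ?thesis
      using inner_plus_ctranspose_nonneg[of "ctranspose Z ** Y"]
      by (simp add: inner_add_right[of Y _ Y] power2_norm_eq_inner)
  qed
  then show ?thesis
    unfolding second_order_critical_frame_potential_iff
    by (intro conjI exI[of _ "\<lambda>_. 1"])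
      (simp_all add: unit_columns_if_orthonormal[OF assms] norm_power2_eq_sum_columns[of Y for Y, symmetric]
        matrix_mul_assoc[symmetric] gram)
qed

text \<open>
  All multipliers equal the frame constant, and the term \<open>Z Z\<^sup>* Y\<close> of the Hessian cancels
  them.
\<close>

lemma critical_if_tight:
  fixes Z :: "complex^'n^'d"
  assumes "unit_norm_tight_frame Z"
  shows "second_order_critical frame_potential column_constraint Z"
proof -
  have unit: "norm (column j Z) = 1" for j
    using assms by (simp add: unit_norm_tight_frame_def)
  define r where "r = real CARD('n) / CARD('d)"
  have tight: "Z ** ctranspose Z = mat (of_real r)"
    using assms frame_constant[OF unit] by (auto simp: unit_norm_tight_frame_def r_def)
  have "r * (norm Y)\<^sup>2 \<le> Y \<bullet> (Z ** ctranspose Z ** Y + (Z ** ctranspose Y + Y ** ctranspose Z) ** Z)" for Y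
  proof -
    have "Z ** ctranspose Y + Y ** ctranspose Z
        = ctranspose (Y ** ctranspose Z) + Y ** ctranspose Z"
      by (simp add: ctranspose_mult)
    then have "Y \<bullet> ((Z ** ctranspose Y + Y ** ctranspose Z) ** Z)
        = (Y ** ctranspose Z) \<bullet> (ctranspose (Y ** ctranspose Z) + Y ** ctranspose Z)"
      by (simp add: inner_mult_right)
    then show ?thesis
      using inner_plus_ctranspose_nonneg[of "Y ** ctranspose Z"]
      by (simp add: inner_add_right[of Y "_ *\<^sub>R _"] tight mat_of_real_mult power2_norm_eq_inner)
  qed
  then show ?thesis
    unfolding second_order_critical_frame_potential_iff
    by (intro conjI exI[of _ "\<lambda>_. r"])
      (simp_all add: unit sum_distrib_left[symmetric] norm_power2_eq_sum_columns[of Y for Y, symmetric]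
        tight mat_of_real_mult)
qed

section \<open>Critical points are orthonormal or tight\<close>

definition outer :: "complex^'d \<Rightarrow> complex^'n \<Rightarrow> complex^'n^'d"
  where "outer v a = (\<chi> i j. v $ i * a $ j)"

lemma outer_nth: "outer v a $ i $ j = v $ i * a $ j"
  by (simp add: outer_def)

lemma mult_outer: "A ** outer v a = outer (A *v v) a"
  by (simp add: vec_eq_iff outer_nth matrix_mult_nth matrix_vector_mult_def sum_distrib_left mult_ac)

lemma norm_column_outer: "(norm (column j (outer v a)))\<^sup>2 = (norm v)\<^sup>2 * (cmod (a $ j))\<^sup>2"
  by (simp add: norm_vec_power2 column_nth outer_nth norm_mult power_mult_distrib sum_distrib_right)

lemma norm_outer: "(norm (outer v a))\<^sup>2 = (norm v)\<^sup>2 * (norm a)\<^sup>2"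
  by (simp add: norm_power2_eq_sum_columns norm_column_outer norm_vec_power2[of a] sum_distrib_left)

text \<open>
  A linear dependence among the columns of \<open>Z\<close>, used as coefficients of a rank-one perturbation,
  makes the first-order change of the frame operator vanish.
\<close>

lemma mult_ctranspose_outer:
  fixes Z :: "complex^'n^'d"
  assumes "Z *v (\<chi> j. cnj (a $ j)) = 0"
  shows "Z ** ctranspose (outer v a) = 0"
proof -
  have "(Z ** ctranspose (outer v a)) $ i $ l = (Z *v (\<chi> j. cnj (a $ j))) $ i * cnj (v $ l)" for i l
    by (simp add: outer_nth matrix_mult_nth matrix_vector_mult_def sum_distrib_left mult_ac)
  then show ?thesis
    by (simp add: assms vec_eq_iff)
qed

text \<open>
  The conditions of \<open>second_order_critical_frame_potential_iff\<close> for one fixed choice of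
  multipliers, which the arguments below compare with each other.
\<close>

locale critical_frame =
  fixes Z :: "complex^'n^'d" and \<mu> :: "'n \<Rightarrow> real"
  assumes unit: "norm (column j Z) = 1"
    and eigen: "(Z ** ctranspose Z ** Z) $ i $ j = \<mu> j *\<^sub>R (Z $ i $ j)"
    and second_order: "(\<And>j. column j Z \<bullet> column j Y = 0) \<Longrightarrow>
      (\<Sum>j\<in>UNIV. \<mu> j * (norm (column j Y))\<^sup>2)
        \<le> Y \<bullet> (Z ** ctranspose Z ** Y + (Z ** ctranspose Y + Y ** ctranspose Z) ** Z)"
begin

definition "G = ctranspose Z ** Z"

lemma ctranspose_G [simp]: "ctranspose G = G"
  by (simp add: G_def ctranspose_mult)

lemma cnj_G: "cnj (G $ j $ l) = G $ l $ j"
  by (metis ctranspose_G ctranspose_nth)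

lemma G_diagonal: "G $ j $ j = 1"
  by (simp add: G_def gram_diagonal unit)

text \<open>
  The eigenvector equations \<open>S z\<^sub>j = \<mu>\<^sub>j z\<^sub>j\<close>, multiplied by \<open>Z\<^sup>*\<close>.
\<close>

lemma G_square_nth: "(G ** G) $ l $ j = of_real (\<mu> j) * G $ l $ j"
proof -
  have "G ** G = ctranspose Z ** (Z ** ctranspose Z ** Z)"
    by (simp add: G_def matrix_mul_assoc)
  then show ?thesis
    by (simp add: matrix_mult_nth[of "ctranspose Z"] eigen G_def sum_distrib_left
        scaleR_conv_of_real[where 'a=complex] mult_ac)
qed

text \<open>
  Eigenvectors of the self-adjoint frame operator for different eigenvalues are orthogonal; on the
  level of \<open>G\<close> this is the comparison of \<open>G\<^sup>2\<close> with its adjoint.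
\<close>

lemma multiplier_eq: "\<mu> j = \<mu> l" if "G $ l $ j \<noteq> 0"
proof -
  have "of_real (\<mu> j) * G $ l $ j = (G ** G) $ l $ j"
    by (simp add: G_square_nth)
  also have "\<dots> = cnj ((G ** G) $ j $ l)"
    by (metis ctranspose_G ctranspose_mult ctranspose_nth)
  also have "\<dots> = of_real (\<mu> l) * G $ l $ j"
    by (simp add: G_square_nth cnj_G)
  finally show ?thesis
    using that by simp
qed

lemma multiplier_eq_norm: "\<mu> j = (norm (column j G))\<^sup>2"
proof -
  have "complex_of_real (\<mu> j) = complex_of_real ((norm (column j G))\<^sup>2)"
    using gram_diagonal[of G j] by (simp add: G_square_nth G_diagonal)
  then show ?thesis
    using of_real_eq_iff by blast
qed

lemma multiplier_eq_sum: "\<mu> j = 1 + (\<Sum>l\<in>UNIV - {j}. (cmod (G $ l $ j))\<^sup>2)"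
  unfolding multiplier_eq_norm norm_vec_power2 column_nth
  by (subst sum.remove[of _ j]) (simp_all add: G_diagonal)

lemma multiplier_ge_1: "1 \<le> \<mu> j"
  by (simp add: multiplier_eq_sum sum_nonneg)

lemma orthonormal_if_multipliers_1:
  assumes "\<And>j. \<mu> j = 1"
  shows "orthonormal_columns Z"
proof -
  have "G $ l $ j = 0" if "l \<noteq> j" for l j
  proof -
    have "(\<Sum>l\<in>UNIV - {j}. (cmod (G $ l $ j))\<^sup>2) = 0"
      using multiplier_eq_sum[of j] assms by simp
    then show ?thesis
      using that by (simp add: sum_nonneg_eq_0_iff)
  qed
  then have "G = mat 1"
    by (simp add: vec_eq_iff mat_def G_diagonal)
  then show ?thesis
    by (simp add: orthonormal_columns_iff_gram G_def)
qed

text \<open>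
  The direction \<open>Y = v a\<^sup>T\<close> has as coefficients the dependence \<open>S z\<^sub>k - \<mu>\<^sub>k z\<^sub>k = 0\<close> among
  the columns. Columns of a different multiplier are orthogonal to \<open>z\<^sub>k\<close> and do not occur in it, so
  the orthogonality assumed of \<open>v\<close> makes \<open>Y\<close> tangent. The dependence is nontrivial because its
  coefficient at \<open>z\<^sub>k\<close> is \<open>1 - \<mu>\<^sub>k < 0\<close>. Along \<open>Y\<close> the Hessian, up to the factor \<open>4\<close>,
  reduces to \<open>\<langle>S v, v\<rangle> \<parallel>a\<parallel>\<^sup>2\<close> and the multiplier term to \<open>\<mu>\<^sub>k \<parallel>v\<parallel>\<^sup>2 \<parallel>a\<parallel>\<^sup>2\<close>.
\<close>

lemma rank_one_test:
  assumes "1 < \<mu> k" and v: "\<And>j. \<mu> j = \<mu> k \<Longrightarrow> (ctranspose Z *v v) $ j = 0"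
  shows "\<mu> k * (norm v)\<^sup>2 \<le> (norm (ctranspose Z *v v))\<^sup>2"
proof -
  \<comment> \<open>Conjugated, because the dependence has to hold for the coefficients of \<open>Y\<^sup>*\<close>.\<close>
  define a where "a = (\<chi> j. cnj (G $ j $ k - (if j = k then of_real (\<mu> k) else 0)))"
  define Y where "Y = outer v a"
  have a_support: "\<mu> j = \<mu> k" if "a $ j \<noteq> 0" for j
    using that multiplier_eq[of j k] by (auto simp: a_def split: if_splits)
  have "a $ k = of_real (1 - \<mu> k)"
    by (simp add: a_def G_diagonal)
  then have "a $ k \<noteq> 0"
    using assms(1) by (metis diff_gt_0_iff_gt less_irrefl of_real_eq_0_iff neg_less_0_iff_less minus_diff_eq)
  then have a_pos: "0 < (norm a)\<^sup>2"
    by auto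
  have "Z *v (\<chi> j. cnj (a $ j)) = 0"
  proof -
    have "(Z *v (\<chi> j. cnj (a $ j))) $ i
        = (\<Sum>j\<in>UNIV. Z $ i $ j * G $ j $ k - (if j = k then Z $ i $ k * of_real (\<mu> k) else 0))" for i
      unfolding matrix_vector_mult_def a_def
      by (simp add: right_diff_distrib) (intro sum.cong refl, auto)
    also have "\<dots> i = (Z ** ctranspose Z ** Z) $ i $ k - \<mu> k *\<^sub>R (Z $ i $ k)" for i
      by (simp add: sum_subtractf G_def matrix_mul_assoc[symmetric] matrix_mult_nth[of Z]
          scaleR_conv_of_real[where 'a=complex])
    finally show ?thesis
      by (simp add: vec_eq_iff eigen)
  qed
  then have ZY: "Z ** ctranspose Y = 0"
    unfolding Y_def by (rule mult_ctranspose_outer)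
  moreover have "Y ** ctranspose Z = ctranspose (Z ** ctranspose Y)"
    by (simp add: ctranspose_mult)
  ultimately have YZ: "Y ** ctranspose Z = 0"
    by (simp add: vec_eq_iff)
  have tangent: "column j Z \<bullet> column j Y = 0" for j
    using v[of j] a_support[of j]
    by (cases "a $ j = 0") (simp_all add: gram_eq_inner Y_def mult_outer outer_nth)
  have "\<mu> k * (norm v)\<^sup>2 * (norm a)\<^sup>2 = (\<Sum>j\<in>UNIV. \<mu> j * (norm (column j Y))\<^sup>2)"
    unfolding Y_def norm_column_outer norm_vec_power2[of a] sum_distrib_left
    using a_support by (intro sum.cong refl) force
  also have "\<dots> \<le> Y \<bullet> (Z ** ctranspose Z ** Y)"
    using second_order[of Y, OF tangent] by (simp add: ZY YZ)
  also have "\<dots> = (norm (ctranspose Z ** Y))\<^sup>2"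
    by (simp add: power2_norm_eq_inner inner_mult_left matrix_mul_assoc)
  also have "\<dots> = (norm (ctranspose Z *v v))\<^sup>2 * (norm a)\<^sup>2"
    by (simp add: Y_def mult_outer norm_outer)
  finally show ?thesis
    using a_pos by simp
qed

lemma ctranspose_mult_column: "ctranspose Z *v column j Z = column j G"
  by (simp add: vec_eq_iff G_def column_nth matrix_vector_mult_def matrix_mult_nth)

text \<open>
  Test with \<open>v = z\<^sub>j\<close>: it is orthogonal to the columns with multiplier \<open>\<mu>\<^sub>k \<noteq> \<mu>\<^sub>j\<close>, and
  \<open>\<langle>S z\<^sub>j, z\<^sub>j\<rangle> = \<mu>\<^sub>j\<close>.
\<close>

lemma multipliers_eq_if_max:
  assumes "1 < \<mu> k" and max: "\<And>j. \<mu> j \<le> \<mu> k"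
  shows "\<mu> j = \<mu> k"
proof (rule ccontr)
  assume neq: "\<mu> j \<noteq> \<mu> k"
  have "(ctranspose Z *v column j Z) $ l = 0" if "\<mu> l = \<mu> k" for l
    using multiplier_eq[of l j] that neq by (auto simp: ctranspose_mult_column column_nth)
  from rank_one_test[OF assms(1) this] have "\<mu> k \<le> \<mu> j"
    by (simp add: unit ctranspose_mult_column multiplier_eq_norm[of j])
  then show False
    using max[of j] neq by simp
qed

text \<open>
  If \<open>S\<close> were not scalar, some column \<open>v\<close> of \<open>D = S - r I\<close> would be nonzero. Since \<open>D\<close> is
  self-adjoint and kills every \<open>z\<^sub>j\<close>, this \<open>v\<close> is orthogonal to all columns of \<open>Z\<close>, so \<open>Z\<^sup>* v = 0\<close>
  and the test fails.
\<close>

lemma tight_if_multipliers_eq: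
  assumes "1 < r" and r: "\<And>j. \<mu> j = r"
  shows "Z ** ctranspose Z = mat (of_real r)"
proof -
  define D where "D = Z ** ctranspose Z - mat (of_real r)"
  have "D ** Z = 0"
    by (simp add: D_def bounded_bilinear.diff_left[OF bounded_bilinear_matrix_mult] mat_of_real_mult vec_eq_iff eigen r)
  moreover have "ctranspose D = D"
    by (simp add: D_def bounded_linear.linear[OF bounded_linear_ctranspose, THEN linear_diff] ctranspose_mult ctranspose_mat_of_real)
  ultimately have "ctranspose Z ** D = 0"
    by (metis ctranspose_mult ctranspose_ctranspose bounded_linear.linear[OF bounded_linear_ctranspose, THEN linear_0])
  have "column l D = 0" for l
  proof -
    have "ctranspose Z *v column l D = column l (ctranspose Z ** D)"
      by (simp add: vec_eq_iff column_nth matrix_vector_mult_def matrix_mult_nth)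
    also have "\<dots> = 0"
      by (simp add: \<open>ctranspose Z ** D = 0\<close> vec_eq_iff column_nth)
    finally have "ctranspose Z *v column l D = 0" .
    then have "r * (norm (column l D))\<^sup>2 \<le> 0"
      using rank_one_test[of _ "column l D"] assms by simp
    then show ?thesis
      using assms(1) by (simp add: mult_le_0_iff)
  qed
  then have "D = 0"
    by (simp add: vec_eq_iff column_nth)
  then show ?thesis
    by (simp add: D_def)
qed

lemma orthonormal_or_tight: "orthonormal_columns Z \<or> unit_norm_tight_frame Z"
proof -
  obtain k where k: "\<And>j. \<mu> j \<le> \<mu> k"
  proof -
    have "Max (range \<mu>) \<in> range \<mu>"
      by (intro Max_in) auto
    then obtain k where "\<mu> k = Max (range \<mu>)"
      by (metis imageE)
    then have "\<mu> j \<le> \<mu> k" for j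
      by simp
    then show ?thesis by (rule that)
  qed
  show ?thesis
  proof (cases "\<mu> k = 1")
    case True
    then have "\<mu> j = 1" for j
      using multiplier_ge_1[of j] k[of j] by linarith
    then show ?thesis
      using orthonormal_if_multipliers_1 by blast
  next
    case False
    then have gt: "1 < \<mu> k"
      using multiplier_ge_1[of k] by linarith
    have "Z ** ctranspose Z = mat (of_real (\<mu> k))"
      by (rule tight_if_multipliers_eq[OF gt multipliers_eq_if_max[OF gt k]])
    then show ?thesis
      using unit by (auto simp: unit_norm_tight_frame_def)
  qed
qed

end

lemma orthonormal_or_tight_if_critical:
  assumes "second_order_critical frame_potential column_constraint Z"
  shows "orthonormal_columns Z \<or> unit_norm_tight_frame Z"
proof -
  from assms obtain \<mu> where "critical_frame Z \<mu>"
    unfolding second_order_critical_frame_potential_iff critical_frame_def by blast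
  then show ?thesis
    by (rule critical_frame.orthonormal_or_tight)
qed

section \<open>The lower bounds are attained\<close>

lemma ex_orthonormal_columns:
  assumes "CARD('n) \<le> CARD('d)"
  shows "\<exists>Z :: complex^'n^'d. orthonormal_columns Z"
proof -
  obtain f :: "'n \<Rightarrow> 'd" where f: "inj f"
    using card_le_inj[of "UNIV :: 'n set" "UNIV :: 'd set"] assms by auto
  define Z :: "complex^'n^'d" where "Z = (\<chi> i j. if i = f j then 1 else 0)"
  have "(\<Sum>i\<in>UNIV. cnj (column j Z $ i) * column k Z $ i) = (if j = k then 1 else 0)" for j k
  proof -
    have "(\<Sum>i\<in>UNIV. cnj (column j Z $ i) * column k Z $ i)
        = (\<Sum>i\<in>UNIV. if i = f j then (if j = k then 1 else 0) else 0)"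
      using injD[OF f, of j k] by (intro sum.cong refl) (auto simp: Z_def column_nth)
    then show ?thesis by simp
  qed
  then show ?thesis
    unfolding orthonormal_columns_def by blast
qed

text \<open>
  The harmonic frame: \<open>d\<close> rows of the \<open>n \<times> n\<close> discrete Fourier matrix, scaled to unit columns.
  The rows are orthogonal because the powers of an \<open>n\<close>th root of unity other than \<open>1\<close> sum to zero.
\<close>

lemma ex_unit_norm_tight_frame:
  assumes "CARD('d) \<le> CARD('n)"
  shows "\<exists>Z :: complex^'n^'d. unit_norm_tight_frame Z"
proof -
  let ?n = "CARD('n)" and ?d = "CARD('d)"
  obtain \<phi> :: "'d \<Rightarrow> nat" where \<phi>: "bij_betw \<phi> UNIV {0..<?d}"
    using ex_bij_betw_finite_nat[of "UNIV :: 'd set"] by auto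
  obtain \<psi> :: "'n \<Rightarrow> nat" where \<psi>: "bij_betw \<psi> UNIV {0..<?n}"
    using ex_bij_betw_finite_nat[of "UNIV :: 'n set"] by auto
  define w where "w i = exp (2 * of_real pi * \<i> * of_nat (\<phi> i) / of_nat ?n)" for i
  have w_norm: "cmod (w i) = 1" for i
    by (simp add: w_def)
  have w_unit: "w i * cnj (w i) = 1" for i
    by (simp add: complex_norm_square[symmetric] w_norm)
  have w_root: "w i ^ ?n = 1" for i
    unfolding w_def by (rule complex_root_unity) simp
  have w_inj: "i = l" if "w i = w l" for i l
  proof -
    have lt: "\<phi> i < ?n" for i
      using bij_betwE[OF \<phi>, rule_format, of i] assms by simp
    have "\<phi> i mod ?n = \<phi> l mod ?n"
      using that complex_root_unity_eq[of ?n "\<phi> i" "\<phi> l"] by (simp add: w_def Suc_leI)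
    then have "\<phi> i = \<phi> l"
      using lt by simp
    then show ?thesis
      using \<phi> by (auto simp: bij_betw_def inj_on_def)
  qed
  define Z :: "complex^'n^'d" where "Z = (\<chi> i j. w i ^ \<psi> j / of_real (sqrt ?d))"
  have unit: "norm (column j Z) = 1" for j
  proof -
    have "(norm (column j Z))\<^sup>2 = 1"
      by (simp add: norm_vec_power2 column_nth Z_def norm_divide norm_power w_norm power_divide)
    then show ?thesis
      using norm_ge_zero[of "column j Z"] by (smt (verit) power2_eq_1_iff)
  qed
  have "(Z ** ctranspose Z) $ i $ l = (if i = l then of_real (?n / ?d) else 0)" for i l
  proof -
    define z where "z = w i * cnj (w l)"
    have root_d: "complex_of_real (sqrt ?d) * complex_of_real (sqrt ?d) = of_nat ?d"
      by (simp flip: of_real_mult)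
    have "(Z ** ctranspose Z) $ i $ l = (\<Sum>j\<in>UNIV. z ^ \<psi> j / of_nat ?d)"
      by (simp add: matrix_mult_nth Z_def z_def power_mult_distrib root_d)
    also have "\<dots> = (\<Sum>m\<in>{0..<?n}. z ^ m / of_nat ?d)"
      by (rule sum.reindex_bij_betw[OF \<psi>])
    also have "\<dots> = (\<Sum>m<?n. z ^ m) / of_nat ?d"
      by (simp add: sum_divide_distrib lessThan_atLeast0)
    also have "\<dots> = (if i = l then of_real (?n / ?d) else 0)"
    proof (cases "i = l")
      case True
      then show ?thesis by (simp add: z_def w_unit)
    next
      case False
      have "z \<noteq> 1"
      proof
        assume "z = 1"
        then have "w i * (w l * cnj (w l)) = w l"
          by (simp add: z_def mult_ac)
        then show False
          using False w_inj[of i l] by (simp add: w_unit)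
      qed
      moreover have "z ^ ?n = 1"
        by (simp add: z_def power_mult_distrib w_root flip: complex_cnj_power)
      ultimately show ?thesis
        using False by (simp add: geometric_sum)
    qed
    finally show ?thesis .
  qed
  then have "Z ** ctranspose Z = mat (of_real (?n / ?d))"
    by (simp add: vec_eq_iff mat_def)
  then show ?thesis
    using unit unfolding unit_norm_tight_frame_def by blast
qed

section \<open>Global minimizers\<close>

lemma is_arg_min_iff_attained_bound:
  fixes f :: "'a \<Rightarrow> real"
  assumes "\<And>x. P x \<Longrightarrow> m \<le> f x" and "P x0" "f x0 = m"
  shows "is_arg_min f P x \<longleftrightarrow> P x \<and> f x = m"
  unfolding is_arg_min_def using assms by (metis antisym_conv1 not_le)

lemma is_arg_min_iff_orthonormal:
  fixes Z :: "complex^'n^'d"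
  assumes "CARD('n) \<le> CARD('d)"
  shows "is_arg_min frame_potential (\<lambda>W. W \<in> unit_norm_columns) Z \<longleftrightarrow> orthonormal_columns Z"
proof -
  obtain W :: "complex^'n^'d" where W: "orthonormal_columns W"
    using ex_orthonormal_columns[OF assms] ..
  have "is_arg_min frame_potential (\<lambda>W. W \<in> unit_norm_columns) Z
      \<longleftrightarrow> Z \<in> unit_norm_columns \<and> frame_potential Z = CARD('n)"
  proof (rule is_arg_min_iff_attained_bound)
    show "CARD('n) \<le> frame_potential V" if "V \<in> unit_norm_columns" for V :: "complex^'n^'d"
      using frame_potential_minus_card[of V] that
      by (simp add: unit_norm_columns_def) (metis diff_ge_0_iff_ge zero_le_power2)
    show "W \<in> unit_norm_columns" "frame_potential W = CARD('n)"
      using W unit_columns_if_orthonormal[OF W] orthonormal_columns_iff_frame_potential[of W]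
      by (auto simp: unit_norm_columns_def)
  qed
  then show ?thesis
    using orthonormal_columns_iff_frame_potential[of Z] unit_columns_if_orthonormal[of Z]
    by (auto simp: unit_norm_columns_def)
qed

lemma is_arg_min_iff_tight:
  fixes Z :: "complex^'n^'d"
  assumes "CARD('d) \<le> CARD('n)"
  shows "is_arg_min frame_potential (\<lambda>W. W \<in> unit_norm_columns) Z \<longleftrightarrow> unit_norm_tight_frame Z"
proof -
  have unit: "V \<in> unit_norm_columns" if "unit_norm_tight_frame V" for V :: "complex^'n^'d"
    using that by (simp add: unit_norm_tight_frame_def unit_norm_columns_def)
  obtain W :: "complex^'n^'d" where W: "unit_norm_tight_frame W"
    using ex_unit_norm_tight_frame[OF assms] ..
  have "is_arg_min frame_potential (\<lambda>W. W \<in> unit_norm_columns) Z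
      \<longleftrightarrow> Z \<in> unit_norm_columns \<and> frame_potential Z = (real CARD('n))\<^sup>2 / CARD('d)"
  proof (rule is_arg_min_iff_attained_bound)
    show "(real CARD('n))\<^sup>2 / CARD('d) \<le> frame_potential V" if "V \<in> unit_norm_columns"
      for V :: "complex^'n^'d"
      using frame_potential_minus_Welch[of V] that
      by (simp add: unit_norm_columns_def) (metis diff_ge_0_iff_ge zero_le_power2)
    show "W \<in> unit_norm_columns" "frame_potential W = (real CARD('n))\<^sup>2 / CARD('d)"
      using W unit[OF W] unit_norm_tight_frame_iff_frame_potential[of W]
      by (auto simp: unit_norm_columns_def)
  qed
  then show ?thesis
    using unit_norm_tight_frame_iff_frame_potential[of Z] unit[of Z]
    by (auto simp: unit_norm_columns_def)
qed

text \<open>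
  For \<open>n \<le> d\<close> the value \<open>n\<^sup>2/d\<close> of a tight frame does not exceed the lower bound \<open>n\<close>, so that
  bound is attained as well; symmetrically in the lemma that follows.
\<close>

lemma orthonormal_if_tight:
  fixes Z :: "complex^'n^'d"
  assumes "CARD('n) \<le> CARD('d)" "unit_norm_tight_frame Z"
  shows "orthonormal_columns Z"
proof -
  have unit: "\<And>j. norm (column j Z) = 1"
    using assms(2) by (simp add: unit_norm_tight_frame_def)
  have "frame_potential Z = (real CARD('n))\<^sup>2 / CARD('d)"
    using assms(2) unit_norm_tight_frame_iff_frame_potential[OF unit] by simp
  also have "\<dots> \<le> CARD('n)"
    using assms(1) by (simp add: divide_le_eq power2_eq_square)
  finally have "(norm (ctranspose Z ** Z - mat 1))\<^sup>2 \<le> 0"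
    using frame_potential_minus_card[OF unit] by linarith
  then show ?thesis
    by (simp add: orthonormal_columns_iff_gram)
qed

lemma tight_if_orthonormal:
  fixes Z :: "complex^'n^'d"
  assumes "CARD('d) \<le> CARD('n)" "orthonormal_columns Z"
  shows "unit_norm_tight_frame Z"
proof -
  note unit = unit_columns_if_orthonormal[OF assms(2)]
  have "frame_potential Z = CARD('n)"
    using assms(2) orthonormal_columns_iff_frame_potential[OF unit] by simp
  also have "\<dots> \<le> (real CARD('n))\<^sup>2 / CARD('d)"
    using assms(1) by (simp add: le_divide_eq power2_eq_square)
  finally have "(norm (Z ** ctranspose Z - mat (of_real (CARD('n) / CARD('d)))))\<^sup>2 \<le> 0"
    using frame_potential_minus_Welch[OF unit] by linarith
  then have "Z ** ctranspose Z = mat (of_real (CARD('n) / CARD('d)))"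
    by simp
  then show ?thesis
    using unit unfolding unit_norm_tight_frame_def by blast
qed

theorem theorem1:
  shows "{Z :: complex^'n^'d. second_order_critical frame_potential column_constraint Z} =
           {Z. is_arg_min frame_potential (\<lambda>W. W \<in> unit_norm_columns) Z}
       \<and> (CARD('n) \<le> CARD('d) \<longrightarrow>
           {Z :: complex^'n^'d. is_arg_min frame_potential (\<lambda>W. W \<in> unit_norm_columns) Z} =
           {Z. orthonormal_columns Z})
       \<and> (CARD('n) \<ge> CARD('d) \<longrightarrow>
           {Z :: complex^'n^'d. is_arg_min frame_potential (\<lambda>W. W \<in> unit_norm_columns) Z} =
           {Z. unit_norm_tight_frame Z})"
proof -
  have "second_order_critical frame_potential column_constraint Z
      \<longleftrightarrow> is_arg_min frame_potential (\<lambda>W. W \<in> unit_norm_columns) Z" for Z :: "complex^'n^'d"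
  proof (cases "CARD('n) \<le> CARD('d)")
    case True
    then show ?thesis
      using is_arg_min_iff_orthonormal[OF True] orthonormal_or_tight_if_critical[of Z]
        critical_if_orthonormal[of Z] orthonormal_if_tight[OF True] by blast
  next
    case False
    then have le: "CARD('d) \<le> CARD('n)" by simp
    then show ?thesis
      using is_arg_min_iff_tight[OF le] orthonormal_or_tight_if_critical[of Z]
        critical_if_tight[of Z] tight_if_orthonormal[OF le] by blast
  qed
  then show ?thesis
    using is_arg_min_iff_orthonormal is_arg_min_iff_tight by blast
qed

end
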